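(* Let $N=\prod_{i=1}^a p_i^{n_i}$ be the prime factorization of $N$, where $p_1<p_2<\cdots<p_a$ are primes, $n_i>0$ for all $i$, and $a\geq 2$. Then $$\mathrm{box}(\Gamma(\mathbb{Z}_N))=\begin{cases} a-1 & \text{if } N\equiv 2\pmod 4 \text{ and } n_i\leq 2 \text{ for all } 2\leq i\leq a,\\ a & \text{otherwise.}\end{cases}$$
   Context: $\mathbb{Z}_N$ is the ring of integers modulo $N$. For a commutative ring $R$, $Z(R)=\{x\in R\setminus\{0\} : \exists\, y\in R\setminus\{0\} \text{ with } xy=0\}$ is the set of (nonzero) zero divisors. The zero divisor graph $\Gamma(R)$ is the simple graph with vertex set $Z(R)$ in which two distinct vertices $x,y$ are adjacent if and only if $xy=0$ in $R$. A $d$-dimensional box is a product $[a_1,b_1]\times\cdots\times[a_d,b_d]$ of closed intervals of the real line. The boxicity $\mathrm{box}(G)$ of a graph $G$ is the minimum integer $d\geq 0$ such that one can assign to every vertex $v$ a $d$-dimensional box $f(v)$ so that distinct vertices $u,v$ are adjacent in $G$ if and only if $f(u)\cap f(v)\neq\emptyset$. In particular complete graphs have boxicity $0$. *)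

theory Defs
  imports
    "HOL-Number_Theory.Residues"
    "HOL-Library.FuncSet"
    "Graph_Theory.Pair_Digraph"
    Complex_Main
begin

text \<open>Zero divisors in this sense are nonzero elements of the ring.\<close>

definition zero_divisors :: "('a, 'b) ring_scheme \<Rightarrow> 'a set" where
  "zero_divisors R =
    {x \<in> carrier R - {\<zero>\<^bsub>R\<^esub>}. \<exists>y \<in> carrier R - {\<zero>\<^bsub>R\<^esub>}. x \<otimes>\<^bsub>R\<^esub> y = \<zero>\<^bsub>R\<^esub>}"

text \<open>
  A simple graph is represented, as in the locale \<^locale>\<open>pair_graph\<close>, by a symmetric irreflexive
  arc relation: the undirected edge between x and y is the pair of arcs (x, y) and (y, x).
\<close>

definition zero_divisor_graph :: "('a, 'b) ring_scheme \<Rightarrow> 'a pair_pre_digraph" where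
  "zero_divisor_graph R =
    \<lparr> pverts = zero_divisors R,
      parcs = {(x, y). x \<in> zero_divisors R \<and> y \<in> zero_divisors R \<and> x \<noteq> y \<and>
                       x \<otimes>\<^bsub>R\<^esub> y = \<zero>\<^bsub>R\<^esub>} \<rparr>"

lemma pair_graph_zero_divisor_graph:
  assumes "cring R" and "finite (carrier R)"
  shows "pair_graph (zero_divisor_graph R)"
proof -
  interpret cring R by fact
  have fin: "finite (zero_divisors R)"
    using assms(2) by (auto simp: zero_divisors_def)
  have "finite (parcs (zero_divisor_graph R))"
    by (rule finite_subset[OF _ finite_cartesian_product[OF fin fin]])
       (auto simp: zero_divisor_graph_def)
  then show ?thesis
    using fin
    by unfold_locales
       (auto simp: zero_divisor_graph_def zero_divisors_def symmetric_def intro!: symI m_comm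
          dest: m_comm)
qed

text \<open>
  Points of d-dimensional space are extensional functions on {..<d}, so that the dimension can vary.
  The intervals are nonempty, and the only 0-dimensional box is the one-point space.
\<close>

definition is_box :: "nat \<Rightarrow> (nat \<Rightarrow> real) set \<Rightarrow> bool" where
  "is_box d B \<longleftrightarrow>
    (\<exists>l u. (\<forall>i<d. l i \<le> u i) \<and> B = (\<Pi>\<^sub>E i\<in>{..<d}. {l i..u i}))"

definition box_representation ::
  "'a pair_pre_digraph \<Rightarrow> nat \<Rightarrow> ('a \<Rightarrow> (nat \<Rightarrow> real) set) \<Rightarrow> bool" where
  "box_representation G d f \<longleftrightarrow>
    (\<forall>v\<in>pverts G. is_box d (f v)) \<and>
    (\<forall>u\<in>pverts G. \<forall>v\<in>pverts G. u \<noteq> v \<longrightarrow> ((u, v) \<in> parcs G \<longleftrightarrow> f u \<inter> f v \<noteq> {}))"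

text \<open>
  Every finite graph has a box representation; for a graph without one the value is unspecified.
\<close>

definition boxicity :: "'a pair_pre_digraph \<Rightarrow> nat" where
  "boxicity G = (LEAST d. \<exists>f. box_representation G d f)"

end

theory Submission
  imports Defs
begin

text \<open>
  Vertices x and y are adjacent iff the multiplicities of each p i in x and y add up to at
  least n i. For a fixed i this is a threshold condition, hence defines an interval graph, and
  dimension a suffices. If N is twice an odd number and all other exponents are at most 2, the
  condition at the prime 2 (x and y are not both odd) can be absorbed into the remaining intervals,
  because N / 2 is the only odd vertex with all multiplicities maximal.

  For the lower bounds, nonadjacent pairs of vertices with all edges between distinct pairs must be
  separated in distinct dimensions. With Q i = N / p i ^ n i, the pairs (Q i, N - Q i) work unless
  p i ^ n i = 2. If p 1 ^ n 1 = 2 and n j > 2, one takes the pairs (Q 1, Q 1 / p j) and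
  (p j * Q j, N - p j * Q j) for the indices 1 and j.
\<close>

section \<open>Boxicity\<close>

lemma boxicity_eqI:
  assumes "\<exists>f. box_representation G d f"
    and "\<And>d' f. box_representation G d' f \<Longrightarrow> d \<le> d'"
  shows "boxicity G = d"
  unfolding boxicity_def using assms by (intro Least_equality) auto

lemma is_boxI:
  "(\<And>t. t < d \<Longrightarrow> l t \<le> u t) \<Longrightarrow> is_box d (\<Pi>\<^sub>E t\<in>{..<d}. {l t..u t})"
  unfolding is_box_def by (rule exI[of _ l], rule exI[of _ u]) simp

text \<open>Products of sets intersect coordinate by coordinate. The endpoint test in each
  coordinate relies on both intervals being nonempty.\<close>

lemma boxes_meet_iff:
  fixes l h l' h' :: "nat \<Rightarrow> real"
  assumes "\<And>t. t < d \<Longrightarrow> l t \<le> h t" "\<And>t. t < d \<Longrightarrow> l' t \<le> h' t"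
  shows "(\<Pi>\<^sub>E t\<in>{..<d}. {l t..h t}) \<inter> (\<Pi>\<^sub>E t\<in>{..<d}. {l' t..h' t}) \<noteq> {} \<longleftrightarrow>
    (\<forall>t<d. l t \<le> h' t \<and> l' t \<le> h t)"
proof -
  have "{l t..h t} \<inter> {l' t..h' t} \<noteq> {} \<longleftrightarrow> l t \<le> h' t \<and> l' t \<le> h t" if "t < d" for t
    using assms[OF that] by (simp only: Int_atLeastAtMost atLeastatMost_empty_iff2 not_not) auto
  then show ?thesis by (simp only: PiE_Int PiE_eq_empty_iff) auto
qed

lemma box_representation_intervals:
  fixes L U :: "nat \<Rightarrow> 'a \<Rightarrow> real"
  assumes le: "\<And>t x. t < d \<Longrightarrow> x \<in> pverts G \<Longrightarrow> L t x \<le> U t x"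
    and adj: "\<And>x y. x \<in> pverts G \<Longrightarrow> y \<in> pverts G \<Longrightarrow> x \<noteq> y \<Longrightarrow>
      (x, y) \<in> parcs G \<longleftrightarrow> (\<forall>t<d. L t x \<le> U t y \<and> L t y \<le> U t x)"
  shows "\<exists>f. box_representation G d f"
proof -
  define f where "f x = (\<Pi>\<^sub>E t\<in>{..<d}. {L t x..U t x})" for x
  have "f x \<inter> f y \<noteq> {} \<longleftrightarrow> (\<forall>t<d. L t x \<le> U t y \<and> L t y \<le> U t x)"
    if "x \<in> pverts G" "y \<in> pverts G" for x y
    unfolding f_def using le that by (intro boxes_meet_iff) auto
  moreover have "is_box d (f x)" if "x \<in> pverts G" for x
    unfolding f_def by (rule is_boxI) (rule le[OF _ that])
  ultimately have "box_representation G d f"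
    unfolding box_representation_def using adj by auto
  then show ?thesis by blast
qed

text \<open>The vertices of any two pairs induce a 4-cycle, which is not an interval graph. Hence
  distinct pairs are separated in distinct coordinates, which gives an injection from
  \<open>I\<close> into the \<open>d\<close> coordinates.\<close>

lemma box_representation_cocktail_party:
  assumes rep: "box_representation G d f" and "finite I"
    and verts: "\<And>i. i \<in> I \<Longrightarrow> u i \<in> pverts G \<and> v i \<in> pverts G"
    and nonadj: "\<And>i. i \<in> I \<Longrightarrow> u i \<noteq> v i \<and> (u i, v i) \<notin> parcs G"
    and adj: "\<And>i k x y. i \<in> I \<Longrightarrow> k \<in> I \<Longrightarrow> i \<noteq> k \<Longrightarrow> x \<in> {u i, v i} \<Longrightarrow> y \<in> {u k, v k} \<Longrightarrow>
      x \<noteq> y \<and> (x, y) \<in> parcs G"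
  shows "card I \<le> d"
proof -
  have "\<exists>l h. (\<forall>t<d. l t \<le> h t) \<and> f x = (\<Pi>\<^sub>E t\<in>{..<d}. {l t..h t})" if "x \<in> pverts G" for x
    using rep that unfolding box_representation_def is_box_def by blast
  then obtain l h where box: "\<And>x t. x \<in> pverts G \<Longrightarrow> t < d \<Longrightarrow> l x t \<le> (h x t :: real)"
      "\<And>x. x \<in> pverts G \<Longrightarrow> f x = (\<Pi>\<^sub>E t\<in>{..<d}. {l x t..h x t})"
    by metis
  have arc: "(x, y) \<in> parcs G \<longleftrightarrow> (\<forall>t<d. l x t \<le> h y t \<and> l y t \<le> h x t)"
    if "x \<in> pverts G" "y \<in> pverts G" "x \<noteq> y" for x y
  proof -
    have "(x, y) \<in> parcs G \<longleftrightarrow> f x \<inter> f y \<noteq> {}"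
      using rep that unfolding box_representation_def by blast
    also have "\<dots> \<longleftrightarrow> (\<forall>t<d. l x t \<le> h y t \<and> l y t \<le> h x t)"
      unfolding box(2)[OF that(1)] box(2)[OF that(2)] using box(1) that(1,2)
      by (intro boxes_meet_iff) auto
    finally show ?thesis .
  qed
  have "\<exists>t<d. h (u i) t < l (v i) t \<or> h (v i) t < l (u i) t" if "i \<in> I" for i
    using arc[of "u i" "v i"] verts[OF that] nonadj[OF that] by (auto simp: not_le)
  then obtain t where t: "\<And>i. i \<in> I \<Longrightarrow> t i < d"
      "\<And>i. i \<in> I \<Longrightarrow> h (u i) (t i) < l (v i) (t i) \<or> h (v i) (t i) < l (u i) (t i)"
    by metis
  have "inj_on t I"
  proof (rule inj_onI, rule ccontr)
    fix i k assume ik: "i \<in> I" "k \<in> I" "t i = t k" "i \<noteq> k"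
    have "l x (t i) \<le> h y (t i) \<and> l y (t i) \<le> h x (t i)"
      if "x \<in> {u i, v i}" "y \<in> {u k, v k}" for x y
      using arc[of x y] adj[OF ik(1,2,4) that] verts ik(1,2) t(1)[OF ik(1)] that by blast
    \<comment> \<open>For instance, writing \<open>t\<close> for the shared coordinate, \<open>h (u
      i) t < l (v i) t \<le> h (u k) t < l (v k) t \<le> h (u i) t\<close> is a contradiction; the
      other orientations are symmetric.\<close>
    from this[of "u i" "u k"] this[of "u i" "v k"] this[of "v i" "u k"] this[of "v i" "v k"]
    show False using t(2)[OF ik(1)] t(2)[OF ik(2)] ik(3) by auto
  qed
  moreover have "t ` I \<subseteq> {..<d}" using t(1) by auto
  ultimately show ?thesis
    using card_inj_on_le[of t I "{..<d}"] by simp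
qed

section \<open>Interval representations\<close>

text \<open>The offset \<open>\<delta>\<close> separates distinct elements that have the same small multiplicity e.\<close>

definition threshold_lo :: "nat \<Rightarrow> nat \<Rightarrow> real \<Rightarrow> real" where
  "threshold_lo n e \<delta> = (if 2 * e < n then real n - real e + \<delta> else 0)"

definition threshold_hi :: "nat \<Rightarrow> nat \<Rightarrow> real \<Rightarrow> real" where
  "threshold_hi n e \<delta> = (if 2 * e < n then real n - real e + \<delta> else real e + 1/2)"

lemma threshold_lo_le_hi: "threshold_lo n e \<delta> \<le> threshold_hi n e \<delta>"
  by (simp add: threshold_lo_def threshold_hi_def)

text \<open>Elements with \<open>2 * e < n\<close> become single points, pairwise distinct thanks to
  the offsets; the others become intervals that all contain 0. The point
  \<open>n - e + \<delta>\<close> lies below \<open>e' + 1/2\<close> iff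
  \<open>n - e \<le> e'\<close>, because \<open>\<delta>\<close> is between 0 and 1/2.\<close>

lemma threshold_intervals_meet:
  assumes "0 < \<delta>" "\<delta> < 1/2" "0 < \<epsilon>" "\<epsilon> < 1/2" "\<delta> \<noteq> \<epsilon>"
  shows "threshold_lo n e \<delta> \<le> threshold_hi n e' \<epsilon> \<and> threshold_lo n e' \<epsilon> \<le> threshold_hi n e \<delta>
    \<longleftrightarrow> n \<le> e + e'"
proof -
  consider "2 * e < n" "2 * e' < n" "e \<noteq> e'" | "2 * e < n" "2 * e' < n" "e = e'"
    | "2 * e < n" "\<not> 2 * e' < n" "n \<le> e + e'" | "2 * e < n" "\<not> 2 * e' < n" "n \<ge> e + e' + 1"
    | "\<not> 2 * e < n" "2 * e' < n" "n \<le> e + e'" | "\<not> 2 * e < n" "2 * e' < n" "n \<ge> e + e' + 1"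
    | "\<not> 2 * e < n" "\<not> 2 * e' < n"
    by linarith
  then show ?thesis
    using assms unfolding threshold_lo_def threshold_hi_def by cases auto
qed

text \<open>b says that the element is odd.\<close>

definition parity_lo :: "nat \<Rightarrow> bool \<Rightarrow> nat \<Rightarrow> real \<Rightarrow> real" where
  "parity_lo n b e \<delta> =
    (if b then (if n \<le> e then -2 else if e = 0 then 2 + \<delta> else 1 + \<delta>)
     else (if n \<le> e then -2 else if e = 0 then -1 - \<delta> else 0))"

definition parity_hi :: "nat \<Rightarrow> bool \<Rightarrow> nat \<Rightarrow> real \<Rightarrow> real" where
  "parity_hi n b e \<delta> =
    (if b then (if n \<le> e then 0 else if e = 0 then 2 + \<delta> else 1 + \<delta>)
     else (if n \<le> e then 3 else if e = 0 then -1 - \<delta> else 3/2))"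

lemma parity_lo_le_hi: "parity_lo n b e \<delta> \<le> parity_hi n b e \<delta>"
  by (simp add: parity_lo_def parity_hi_def)

text \<open>As \<open>n \<le> 2\<close>, only three kinds of \<open>e\<close> occur: 0, 1 below
  \<open>n\<close>, and saturated. Saturated odd elements get [-2, 0], which avoids the points of
  the unsaturated odd ones in (1, 5/2) but reaches every even element: the points below -1, the
  interval [0, 3/2] and the saturated interval [-2, 3].\<close>

lemma parity_intervals_meet:
  assumes "0 < \<delta>" "\<delta> < 1/2" "0 < \<epsilon>" "\<epsilon> < 1/2" "\<delta> \<noteq> \<epsilon>" "0 < n" "n \<le> 2"
  shows "parity_lo n b e \<delta> \<le> parity_hi n b' e' \<epsilon> \<and> parity_lo n b' e' \<epsilon> \<le> parity_hi n b e \<delta>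
    \<longleftrightarrow> n \<le> e + e' \<and> (b \<and> b' \<longrightarrow> n \<le> e \<and> n \<le> e')"
proof -
  have "n \<le> e \<or> e = 0 \<or> (n = 2 \<and> e = 1)" "n \<le> e' \<or> e' = 0 \<or> (n = 2 \<and> e' = 1)"
    using assms(6,7) by auto
  then show ?thesis
    using assms unfolding parity_lo_def parity_hi_def by (elim disjE) auto
qed

section \<open>The zero divisor graph modulo N\<close>

lemma pverts_zero_divisor_graph:
  "pverts (zero_divisor_graph (residue_ring m)) =
    {x. 0 < x \<and> x < m \<and> (\<exists>y. 0 < y \<and> y < m \<and> m dvd x * y)}"
  by (force simp: zero_divisor_graph_def zero_divisors_def residue_ring_def mod_eq_0_iff_dvd)

lemma parcs_zero_divisor_graph:
  "(x, y) \<in> parcs (zero_divisor_graph (residue_ring m)) \<longleftrightarrow>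
    x \<in> pverts (zero_divisor_graph (residue_ring m)) \<and>
    y \<in> pverts (zero_divisor_graph (residue_ring m)) \<and> x \<noteq> y \<and> m dvd x * y"
  by (auto simp: zero_divisor_graph_def residue_ring_def mod_eq_0_iff_dvd)

lemma zero_divisor_graph_vertexI:
  fixes q x m :: int
  assumes "0 < x" "x < m" "1 < q" "q dvd x" "q dvd m"
  shows "x \<in> pverts (zero_divisor_graph (residue_ring m))"
proof -
  \<comment> \<open>The cofactor \<open>r\<close> of \<open>q\<close> in \<open>m\<close>
    annihilates \<open>x\<close>.\<close>
  obtain r s where r: "m = q * r" and s: "x = q * s" using assms by (auto elim!: dvdE)
  have "r > 0" using assms r by (smt (verit) zero_less_mult_pos)
  moreover from this have "r < m" using assms r by simp
  moreover have "m dvd x * r" using r s by simp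
  ultimately show ?thesis using assms by (auto simp: pverts_zero_divisor_graph)
qed

text \<open>Non-divisibility is demanded of squares as well: a vertex lying in two different pairs
  would have its square divisible by \<open>m\<close>, so distinct pairs are disjoint.\<close>

lemma zero_divisor_graph_cocktail_party:
  fixes u v :: "'i \<Rightarrow> int"
  assumes rep: "box_representation (zero_divisor_graph (residue_ring m)) d f" and "finite I"
    and verts: "\<And>i. i \<in> I \<Longrightarrow> u i \<in> pverts (zero_divisor_graph (residue_ring m)) \<and>
      v i \<in> pverts (zero_divisor_graph (residue_ring m))"
    and neq: "\<And>i. i \<in> I \<Longrightarrow> u i \<noteq> v i"
    and nonadj: "\<And>i x y. i \<in> I \<Longrightarrow> x \<in> {u i, v i} \<Longrightarrow> y \<in> {u i, v i} \<Longrightarrow> \<not> m dvd x * y"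
    and adj: "\<And>i k x y. i \<in> I \<Longrightarrow> k \<in> I \<Longrightarrow> i \<noteq> k \<Longrightarrow> x \<in> {u i, v i} \<Longrightarrow> y \<in> {u k, v k} \<Longrightarrow>
      m dvd x * y"
  shows "card I \<le> d"
proof (rule box_representation_cocktail_party[OF rep \<open>finite I\<close>])
  fix i k x y assume *: "i \<in> I" "k \<in> I" "i \<noteq> k" "x \<in> {u i, v i}" "y \<in> {u k, v k}"
  have "m dvd x * y" by (rule adj[OF *])
  moreover have "\<not> m dvd x * x" by (rule nonadj[OF *(1,4,4)])
  ultimately have "x \<noteq> y" by metis
  with \<open>m dvd x * y\<close> show "x \<noteq> y \<and> (x, y) \<in> parcs (zero_divisor_graph (residue_ring m))"
    using verts *(1,2,4,5) unfolding parcs_zero_divisor_graph by blast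
qed (use verts neq nonadj parcs_zero_divisor_graph in blast)+

section \<open>Prime powers of the modulus, their cofactors, and multiplicities\<close>

locale factored_modulus =
  fixes N a :: nat and p n :: "nat \<Rightarrow> nat"
  assumes a_ge_2: "a \<ge> 2"
    and prime_p: "\<And>i. i \<in> {1..a} \<Longrightarrow> prime (p i)"
    and mono_p: "strict_mono_on {1..a} p"
    and n_pos: "\<And>i. i \<in> {1..a} \<Longrightarrow> n i > 0"
    and N_eq: "N = (\<Prod>i=1..a. p i ^ n i)"
begin

abbreviation G :: "int pair_pre_digraph" where
  "G \<equiv> zero_divisor_graph (residue_ring (int N))"

definition P :: "nat \<Rightarrow> int" where "P i = int (p i) ^ n i"

definition Q :: "nat \<Rightarrow> int" where "Q i = (\<Prod>k\<in>{1..a} - {i}. P k)"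

abbreviation val :: "nat \<Rightarrow> int \<Rightarrow> nat" where
  "val i x \<equiv> multiplicity (int (p i)) x"

lemma prime_int_p: "i \<in> {1..a} \<Longrightarrow> prime (int (p i))"
  using prime_p by simp

lemma p_eq_iff: "i \<in> {1..a} \<Longrightarrow> k \<in> {1..a} \<Longrightarrow> p i = p k \<longleftrightarrow> i = k"
  using strict_mono_on_eqD[OF mono_p] by metis

lemma coprime_p: "i \<in> {1..a} \<Longrightarrow> k \<in> {1..a} \<Longrightarrow> i \<noteq> k \<Longrightarrow> coprime (int (p i)) (int (p k))"
  using prime_int_p p_eq_iff by (intro primes_coprime) auto

lemma int_N: "int N = (\<Prod>i\<in>{1..a}. P i)"
  by (simp add: N_eq P_def)

lemma int_N_split: "i \<in> {1..a} \<Longrightarrow> int N = P i * Q i"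
  unfolding int_N Q_def by (rule prod.remove) auto

lemma p_gt_1: "i \<in> {1..a} \<Longrightarrow> int (p i) > 1"
  using prime_gt_1_int[OF prime_int_p] .

lemma P_gt_1: "i \<in> {1..a} \<Longrightarrow> P i > 1"
  unfolding P_def using p_gt_1 n_pos by (simp add: one_less_power)

lemma p_dvd_P: "i \<in> {1..a} \<Longrightarrow> int (p i) dvd P i"
  unfolding P_def using n_pos by (simp add: dvd_power)

lemma Q_pos: "Q i > 0"
  unfolding Q_def by (intro prod_pos) (use P_gt_1 in force)

lemma Q_less_N: "i \<in> {1..a} \<Longrightarrow> Q i < int N"
  using int_N_split[of i] P_gt_1[of i] Q_pos[of i] by simp

lemma P_dvd_Q: "k \<in> {1..a} \<Longrightarrow> k \<noteq> i \<Longrightarrow> P k dvd Q i"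
  unfolding Q_def by (intro dvd_prodI) auto

lemma p_dvd_Q: "k \<in> {1..a} \<Longrightarrow> k \<noteq> i \<Longrightarrow> int (p k) dvd Q i"
  using P_dvd_Q p_dvd_P dvd_trans by blast

lemma not_p_dvd_Q:
  assumes i: "i \<in> {1..a}" shows "\<not> int (p i) dvd Q i"
proof -
  have "coprime (int (p i)) (Q i)"
    unfolding Q_def P_def using i
    by (intro prod_coprime_right coprime_power_right_iff[THEN iffD2] disjI1 coprime_p) auto
  then show ?thesis
    using p_gt_1[OF i] by (auto dest: coprime_common_divisor[OF _ dvd_refl])
qed

text \<open>The prime powers are pairwise coprime, so their product divides \<open>x\<close> iff
  each of them does. The case \<open>x = 0\<close> is excluded because its multiplicity is 0 by
  convention. Besides all of \<open>{1..a}\<close>, the set \<open>S\<close> is later taken to be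
  \<open>{2..a}\<close>, whose product is \<open>Q 1\<close>.\<close>

lemma prod_P_dvd_iff:
  assumes "S \<subseteq> {1..a}" "x \<noteq> 0"
  shows "(\<Prod>i\<in>S. P i) dvd x \<longleftrightarrow> (\<forall>i\<in>S. n i \<le> val i x)"
proof -
  have fin: "finite S" using assms finite_subset by blast
  have val: "P i dvd x \<longleftrightarrow> n i \<le> val i x" if "i \<in> S" for i
    unfolding P_def using prime_int_p[of i] assms that
    by (intro power_dvd_iff_le_multiplicity) (auto simp: prime_int_not_dvd)
  have "(\<Prod>i\<in>S. P i) dvd x" if "\<forall>i\<in>S. P i dvd x"
    using fin that assms(1)
  proof (induction S rule: finite_induct)
    case (insert i S)
    have "coprime (P i) (\<Prod>k\<in>S. P k)"
      unfolding P_def using insert.hyps insert.prems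
      by (intro prod_coprime_right coprime_power_left_iff[THEN iffD2] coprime_power_right_iff[THEN iffD2]
          disjI1 coprime_p) auto
    then show ?case using insert by (simp add: divides_mult)
  qed simp
  moreover have "\<forall>i\<in>S. P i dvd x" if "(\<Prod>i\<in>S. P i) dvd x"
    using that fin by (meson dvd_prodI dvd_trans)
  ultimately show ?thesis using val by blast
qed

lemma N_dvd_mult_iff:
  assumes "x \<noteq> 0" "y \<noteq> 0"
  shows "int N dvd x * y \<longleftrightarrow> (\<forall>i\<in>{1..a}. n i \<le> val i x + val i y)"
  using assms prime_int_p
  by (simp add: int_N prod_P_dvd_iff prime_elem_multiplicity_mult_distrib)

lemma p_eq_2D:
  assumes "i \<in> {1..a}" "p i = 2" shows "i = 1"
proof (rule ccontr)
  assume "i \<noteq> 1"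
  then have "p 1 < p i" using assms a_ge_2 by (intro strict_mono_onD[OF mono_p]) auto
  moreover have "p 1 \<ge> 2" using prime_p[of 1] a_ge_2 by (auto intro: prime_ge_2_nat)
  ultimately show False using assms by simp
qed

lemma P_eq_2D:
  assumes i: "i \<in> {1..a}" and "P i = 2"
  shows "i = 1 \<and> p 1 = 2 \<and> n 1 = 1"
proof -
  have "int (p i) dvd 2" using p_dvd_P[OF i] assms(2) by simp
  then have "int (p i) \<le> 2" by (intro zdvd_imp_le) auto
  then have "p i = 2" using p_gt_1[OF i] by simp
  moreover from this have "i = 1" using p_eq_2D i by blast
  moreover have "(2::int) ^ n 1 = 2 ^ 1" using assms(2) calculation by (simp add: P_def)
  then have "n 1 = 1" by (subst (asm) power_inject_exp) auto
  ultimately show ?thesis by simp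
qed

text \<open>Both sides say that 2 divides \<open>N\<close> exactly once; since the primes increase,
  2 can only be \<open>p 1\<close>. The bounds below use the condition in the form
  \<open>P 1 = 2\<close>.\<close>

lemma cong_2_mod_4_iff: "[N = 2] (mod 4) \<longleftrightarrow> P 1 = 2"
proof
  have 1: "1 \<in> {1..a}" using a_ge_2 by simp
  assume "P 1 = 2"
  then have "p 1 = 2" using P_eq_2D[OF 1] by simp
  then have "odd (Q 1)" using not_p_dvd_Q[OF 1] by simp
  then obtain c where "Q 1 = 2 * c + 1" by (elim oddE)
  then have "int N = 2 + 4 * c" using int_N_split[OF 1] \<open>P 1 = 2\<close> by simp
  then have "[int N = int 2] (mod int 4)" by (simp add: cong_def)
  then show "[N = 2] (mod 4)" by (simp only: cong_int_iff)
next
  assume "[N = 2] (mod 4)"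
  then have "N mod 4 = 2" by (simp add: cong_def)
  then have N: "even N" "\<not> 4 dvd N" by presburger+
  from N(1) obtain i where i: "i \<in> {1..a}" "2 dvd p i ^ n i"
    unfolding N_eq by (subst (asm) prime_dvd_prod_iff) auto
  then have "2 dvd p i" by (simp add: prime_dvd_power_iff)
  then have "p i = 2" using prime_p[OF i(1)] by (metis primes_dvd_imp_eq two_is_prime_nat)
  then have i1: "i = 1" "p 1 = 2" using p_eq_2D i(1) by auto
  have "n 1 < 2"
  proof (rule ccontr)
    assume "\<not> n 1 < 2"
    then have "(2::int) ^ 2 dvd P 1"
      unfolding P_def i1 of_nat_numeral by (intro le_imp_power_dvd) simp
    then have "4 dvd P 1" by simp
    moreover have "P 1 dvd int N" using int_N_split[of 1] a_ge_2 by simp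
    ultimately have "4 dvd int N" by (rule dvd_trans)
    then show False using N(2) by presburger
  qed
  then have "n 1 = 1" using n_pos[of 1] a_ge_2 by simp
  then show "P 1 = 2" unfolding P_def i1(2) by simp
qed

section \<open>Upper bounds\<close>

text \<open>Vertices lie strictly between 0 and \<open>N\<close>, so this scaling embeds them
  injectively into (0, 1/2), as the interval lemmas require.\<close>

definition offset :: "int \<Rightarrow> real" where "offset x = of_int x / (2 * real N)"

lemma offset:
  assumes "x \<in> pverts G" shows "0 < offset x" "offset x < 1/2"
  using assms by (auto simp: offset_def pverts_zero_divisor_graph field_simps)

lemma offset_neq:
  assumes "x \<in> pverts G" "x \<noteq> y" shows "offset x \<noteq> offset y"
  using assms by (auto simp: offset_def pverts_zero_divisor_graph)

lemma box_representation_all: "\<exists>f. box_representation G a f"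
proof (rule box_representation_intervals)
  \<comment> \<open>One coordinate per prime: coordinates count from 0, primes from 1.\<close>
  let ?L = "\<lambda>t x. threshold_lo (n (Suc t)) (val (Suc t) x) (offset x)"
  let ?U = "\<lambda>t x. threshold_hi (n (Suc t)) (val (Suc t) x) (offset x)"
  show "?L t x \<le> ?U t x" for t x by (rule threshold_lo_le_hi)
  fix x y assume xy: "x \<in> pverts G" "y \<in> pverts G" "x \<noteq> y"
  have "(x, y) \<in> parcs G \<longleftrightarrow> int N dvd x * y"
    using xy by (simp add: parcs_zero_divisor_graph)
  also have "\<dots> \<longleftrightarrow> (\<forall>i\<in>{1..a}. n i \<le> val i x + val i y)"
    using xy by (intro N_dvd_mult_iff) (auto simp: pverts_zero_divisor_graph)
  also have "\<dots> \<longleftrightarrow> (\<forall>t<a. n (Suc t) \<le> val (Suc t) x + val (Suc t) y)"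
    by (simp only: image_Suc_lessThan[symmetric] ball_simps) auto
  finally show "(x, y) \<in> parcs G \<longleftrightarrow> (\<forall>t<a. ?L t x \<le> ?U t y \<and> ?L t y \<le> ?U t x)"
    using offset offset_neq xy by (simp add: threshold_intervals_meet)
qed

text \<open>Every coordinate handles one odd prime and also separates two odd elements unless both
  are saturated there. A pair of odd vertices that no coordinate separates would be saturated at all
  odd primes, forcing both to be \<open>Q 1\<close>.\<close>

lemma box_representation_parity:
  assumes P1: "P 1 = 2" and n2: "\<And>i. i \<in> {2..a} \<Longrightarrow> n i \<le> 2"
  shows "\<exists>f. box_representation G (a - 1) f"
proof (rule box_representation_intervals)
  \<comment> \<open>The shift by 2 skips the index 1 of the prime 2.\<close>
  let ?L = "\<lambda>t x. parity_lo (n (t + 2)) (odd x) (val (t + 2) x) (offset x)"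
  let ?U = "\<lambda>t x. parity_hi (n (t + 2)) (odd x) (val (t + 2) x) (offset x)"
  show "?L t x \<le> ?U t x" for t x by (rule parity_lo_le_hi)
  fix x y assume xy: "x \<in> pverts G" "y \<in> pverts G" "x \<noteq> y"
  have 1: "1 \<in> {1..a}" and split: "{1..a} = insert 1 {2..a}" using a_ge_2 by auto
  have pn: "p 1 = 2" "n 1 = 1" using P_eq_2D[OF 1 P1] by auto
  have nz: "x \<noteq> 0" "y \<noteq> 0" using xy by (auto simp: pverts_zero_divisor_graph)
  have meet: "?L t x \<le> ?U t y \<and> ?L t y \<le> ?U t x \<longleftrightarrow>
      n (t + 2) \<le> val (t + 2) x + val (t + 2) y \<and>
      (odd x \<and> odd y \<longrightarrow> n (t + 2) \<le> val (t + 2) x \<and> n (t + 2) \<le> val (t + 2) y)"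
    if "t < a - 1" for t
    using offset offset_neq xy that n2[of "t + 2"] n_pos[of "t + 2"]
    by (intro parity_intervals_meet) auto
  have shift: "(\<forall>t<a - 1. R (t + 2)) \<longleftrightarrow> (\<forall>i\<in>{2..a}. R i)" for R
  proof (intro iffI ballI allI impI)
    fix i assume "\<forall>t<a - 1. R (t + 2)" "i \<in> {2..a}"
    moreover from this(2) have "i - 2 < a - 1" "i - 2 + 2 = i" by auto
    ultimately show "R i" by metis
  qed (use a_ge_2 in auto)
  \<comment> \<open>Saturation makes \<open>z\<close> a multiple of \<open>Q 1\<close>, and
    \<open>Q 1\<close> is the only one strictly between 0 and \<open>N = 2 * Q 1\<close>.\<close>
  have eq_Q1: "z = Q 1" if "z \<in> pverts G" "\<forall>i\<in>{2..a}. n i \<le> val i z" for z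
  proof -
    have z: "0 < z" "z < 2 * Q 1"
      using that(1) int_N_split[OF 1] P1 by (auto simp: pverts_zero_divisor_graph)
    have "{1..a} - {1} = {2..a}" by auto
    then have "Q 1 dvd z"
      unfolding Q_def using that(2) z(1) by (subst prod_P_dvd_iff) auto
    then obtain r where "z = Q 1 * r" by (elim dvdE)
    with z have "0 < r" "r < 2" using Q_pos[of 1]
      by (auto simp: zero_less_mult_iff mult.commute[of "Q 1"])
    then show ?thesis using \<open>z = Q 1 * r\<close> by (simp add: order.antisym)
  qed
  have "(x, y) \<in> parcs G \<longleftrightarrow> int N dvd x * y"
    using xy by (simp add: parcs_zero_divisor_graph)
  also have "\<dots> \<longleftrightarrow> (\<forall>i\<in>{1..a}. n i \<le> val i x + val i y)"
    using nz by (rule N_dvd_mult_iff)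
  also have "\<dots> \<longleftrightarrow> \<not> (odd x \<and> odd y) \<and> (\<forall>i\<in>{2..a}. n i \<le> val i x + val i y)"
  proof -
    have "n 1 \<le> val 1 z \<longleftrightarrow> even z" if "z \<noteq> 0" for z
      using power_dvd_iff_le_multiplicity[where p = 2 and n = 1 and x = z] that by (simp add: pn[unfolded One_nat_def])
    moreover have "n 1 \<le> val 1 x + val 1 y \<longleftrightarrow> n 1 \<le> val 1 x \<or> n 1 \<le> val 1 y"
      unfolding pn by linarith
    ultimately show ?thesis unfolding split using nz by auto
  qed
  \<comment> \<open>From right to left, two odd vertices would both equal \<open>Q 1\<close>,
    contrary to \<open>x \<noteq> y\<close>.\<close>
  also have "\<dots> \<longleftrightarrow> (\<forall>i\<in>{2..a}. n i \<le> val i x + val i y \<and>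
      (odd x \<and> odd y \<longrightarrow> n i \<le> val i x \<and> n i \<le> val i y))"
    using eq_Q1[OF xy(1)] eq_Q1[OF xy(2)] xy(3) by blast
  also have "\<dots> \<longleftrightarrow> (\<forall>t<a - 1. ?L t x \<le> ?U t y \<and> ?L t y \<le> ?U t x)"
    using meet by (simp add: shift[symmetric])
  finally show "(x, y) \<in> parcs G \<longleftrightarrow> (\<forall>t<a - 1. ?L t x \<le> ?U t y \<and> ?L t y \<le> ?U t x)" .
qed

section \<open>Lower bounds\<close>

lemma N_dvd_mult_Q: "k \<in> {1..a} \<Longrightarrow> P k dvd x \<Longrightarrow> int N dvd x * Q k"
  by (simp add: int_N_split mult_dvd_mono)

lemma other_index: "\<exists>k\<in>{1..a}. k \<noteq> i"
  using a_ge_2 by (intro bexI[of _ "if i = 1 then 2 else 1"]) auto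

text \<open>\<open>N - w\<close> represents the negative of \<open>w\<close>, so replacing one by
  the other never affects adjacency conditions.\<close>

lemma N_dvd_mult_diff:
  fixes w x :: int
  shows "int N dvd x * (int N - w) \<longleftrightarrow> int N dvd x * w" "int N dvd (int N - w) * x \<longleftrightarrow> int N dvd w * x"
  unfolding right_diff_distrib left_diff_distrib by (simp_all add: dvd_diff_right_iff)

lemma not_N_dvd_Q_square:
  assumes "i \<in> {1..a}" shows "\<not> int N dvd Q i * Q i"
proof
  assume "int N dvd Q i * Q i"
  then have "int (p i) dvd Q i * Q i"
    using p_dvd_P[OF assms] unfolding int_N_split[OF assms] by (metis dvd_mult_left dvd_trans)
  then show False using not_p_dvd_Q[OF assms] prime_int_p[OF assms] by (auto simp: prime_dvd_mult_iff)
qed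

lemma Q_vertex:
  assumes i: "i \<in> {1..a}" shows "Q i \<in> pverts G" "int N - Q i \<in> pverts G"
proof -
  obtain k where k: "k \<in> {1..a}" "k \<noteq> i" using other_index by blast
  have "int (p k) dvd int N" using p_dvd_P[OF k(1)] int_N_split[OF k(1)] by simp
  then show "Q i \<in> pverts G" "int N - Q i \<in> pverts G"
    using p_dvd_Q[OF k] p_gt_1[OF k(1)] Q_pos[of i] Q_less_N[OF i]
    by (auto intro!: zero_divisor_graph_vertexI[of _ _ "int (p k)"])
qed

text \<open>\<open>Q i\<close> is its own negative modulo \<open>N\<close> only if
  \<open>N = 2 * Q i\<close>.\<close>

lemma Q_neq:
  assumes "i \<in> {1..a}" "P i \<noteq> 2" shows "Q i \<noteq> int N - Q i"
proof
  assume "Q i = int N - Q i"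
  then have "P i * Q i = 2 * Q i" using int_N_split[OF assms(1)] by simp
  then show False using assms(2) Q_pos[of i] by simp
qed

text \<open>The pairs consist of \<open>Q i\<close> and its negative. For
  \<open>i \<noteq> k\<close>, \<open>P k\<close> divides \<open>Q i\<close>, so products across
  pairs vanish, while \<open>Q i * Q i\<close> lacks the prime \<open>p i\<close>. An index with
  \<open>P i = 2\<close> has to be left out, as its pair collapses.\<close>

lemma box_representation_ge:
  assumes "box_representation G d f" "I \<subseteq> {1..a}" "\<And>i. i \<in> I \<Longrightarrow> P i \<noteq> 2"
  shows "card I \<le> d"
proof (rule zero_divisor_graph_cocktail_party[OF assms(1)])
  show "finite I" using assms(2) finite_subset by blast
  show "Q i \<in> pverts G \<and> int N - Q i \<in> pverts G" if "i \<in> I" for i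
    using Q_vertex assms(2) that by blast
  show "Q i \<noteq> int N - Q i" if "i \<in> I" for i
    using Q_neq assms(2,3) that by blast
  show "\<not> int N dvd x * y" if "i \<in> I" "x \<in> {Q i, int N - Q i}" "y \<in> {Q i, int N - Q i}" for i x y
    using not_N_dvd_Q_square[of i] assms(2) that by (auto simp: N_dvd_mult_diff)
  show "int N dvd x * y"
    if "i \<in> I" "k \<in> I" "i \<noteq> k" "x \<in> {Q i, int N - Q i}" "y \<in> {Q k, int N - Q k}" for i k x y
  proof -
    have "int N dvd Q i * Q k" using that assms(2) by (intro N_dvd_mult_Q P_dvd_Q) auto
    then show ?thesis using that(4,5) by (auto simp: N_dvd_mult_diff)
  qed
qed

text \<open>Since \<open>Q 1\<close> is its own negative, it is paired with
  \<open>m = Q 1 / p j\<close> instead. The factor \<open>p j\<close> lost in \<open>m\<close> is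
  restored by using \<open>w = p j * Q j\<close> in place of \<open>Q j\<close>. As \<open>w\<close>
  contains \<open>p j\<close> exactly once, its square still falls short of
  \<open>n j > 2\<close>.\<close>

lemma box_representation_ge_cube:
  assumes rep: "box_representation G d f" and P1: "P 1 = 2" and j: "j \<in> {2..a}" "n j > 2"
  shows "a \<le> d"
proof -
  have ja: "j \<in> {1..a}" "j \<noteq> 1" and 1: "1 \<in> {1..a}" using j by auto
  have p1: "p 1 = 2" using P_eq_2D[OF 1 P1] by simp
  define w where "w = int (p j) * Q j"
  obtain m where m: "Q 1 = int (p j) * m" using p_dvd_Q[OF ja] by (elim dvdE)
  obtain r where r: "n j = Suc (Suc (Suc r))"
    using j(2) by (auto simp: less_iff_Suc_add)
  \<comment> \<open>\<open>q\<close> is \<open>p j ^ (n j - 1)\<close>, the cofactor of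
    \<open>w\<close> in \<open>N\<close>.\<close>
  define q where "q = int (p j) ^ Suc (Suc r)"
  have Nw: "int N = q * w"
    unfolding int_N_split[OF ja(1)] P_def r w_def q_def by (simp only: power_Suc mult_ac)
  have pj: "int (p j) > 1" using p_gt_1 ja by blast
  have "p j \<noteq> 2" using p_eq_2D[OF ja(1)] ja(2) by blast
  then have "odd (int (p j))"
    using primes_dvd_imp_eq[OF two_is_prime_nat prime_p[OF ja(1)]] by auto
  then have "odd q" by (simp add: q_def)
  have "q > 1" unfolding q_def using pj by (intro one_less_power) auto
  have "odd (Q 1)" using not_p_dvd_Q[OF 1] p1 by simp
  then have "odd m" unfolding m by simp
  have "m > 0" using Q_pos[of 1] pj unfolding m by (simp add: zero_less_mult_iff)
  have "m < Q 1" using \<open>m > 0\<close> pj unfolding m by simp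
  have "w > 0" using Q_pos[of j] pj by (simp add: w_def)
  have "w < int N" using \<open>w > 0\<close> \<open>q > 1\<close> unfolding Nw by simp
  have pjw: "int (p j) dvd w" by (simp add: w_def)
  then have pjN: "int (p j) dvd int N" by (simp add: Nw)
  have coprime_pj: "coprime (P k) (int (p j))" if "k \<in> {1..a}" "k \<noteq> j" for k
    using coprime_p[OF that(1) ja(1) that(2)] by (simp add: P_def)
  have P_dvd_m: "P k dvd m" if "k \<in> {1..a}" "k \<noteq> 1" "k \<noteq> j" for k
    using P_dvd_Q[OF that(1,2)] coprime_pj[OF that(1,3)]
    unfolding m by (simp add: coprime_dvd_mult_right_iff)
  \<comment> \<open>\<open>Q 1\<close> contains \<open>p j\<close> at least three times, so
    \<open>m\<close> keeps a common prime factor with \<open>N\<close> and is a vertex.\<close>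
  have pj_dvd_m: "int (p j) dvd m"
  proof -
    have "int (p j) * int (p j) dvd P j" by (simp add: P_def r)
    then have "int (p j) * int (p j) dvd int (p j) * m"
      using P_dvd_Q[OF ja] unfolding m by (rule dvd_trans)
    then show ?thesis using pj by (simp only: dvd_mult_cancel_left) auto
  qed
  have w_square: "\<not> int N dvd w * w"
  proof
    assume "int N dvd w * w"
    then have "q dvd w" using \<open>w > 0\<close> by (simp add: Nw)
    \<comment> \<open>The exponent \<open>Suc r\<close> is \<open>n j - 2\<close>, which is positive
      precisely because \<open>n j > 2\<close>.\<close>
    then have "int (p j) ^ Suc r dvd Q j" using pj by (simp add: q_def w_def)
    then have "int (p j) dvd Q j" unfolding power_Suc by (rule dvd_mult_left)
    then show False using not_p_dvd_Q[OF ja(1)] by blast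
  qed
  define u where "u i = (if i = 1 then Q 1 else if i = j then w else Q i)" for i
  define v where "v i = (if i = 1 then m else if i = j then int N - w else int N - Q i)" for i
  \<comment> \<open>This settles all products within the first pair, since \<open>Q 1\<close> and
    \<open>m\<close> are both odd.\<close>
  have odd_not_dvd: "\<not> int N dvd x * y" if "odd x" "odd y" for x y
  proof
    assume "int N dvd x * y"
    moreover have "2 dvd int N" using int_N_split[OF 1] P1 by simp
    ultimately show False using that dvd_trans even_mult_iff by blast
  qed
  \<comment> \<open>Ordering the indices keeps the exceptional pair at 1 on the left, so
    \<open>k \<noteq> 1\<close>; the other order follows by commutativity.\<close>
  have N_dvd: "int N dvd x * y"
    if "i \<in> {1..a}" "k \<in> {1..a}" "i < k" "x \<in> {u i, v i}" "y \<in> {u k, v k}" for i k x y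
  proof -
    have ik: "i \<noteq> k" "k \<noteq> 1" using that by auto
    have Q_Q: "int N dvd Q i * Q k" using that ik by (intro N_dvd_mult_Q P_dvd_Q) auto
    have w_Q: "int N dvd w * Q k" if "k \<noteq> j"
      using P_dvd_Q[OF \<open>k \<in> {1..a}\<close> that] by (intro N_dvd_mult_Q \<open>k \<in> {1..a}\<close>) (simp add: w_def)
    have Q_w: "int N dvd Q i * w" if "i \<noteq> j"
      using N_dvd_mult_Q[OF ja(1) P_dvd_Q[OF ja(1)], of i] that by (simp add: w_def mult.left_commute)
    have m_Q: "int N dvd m * Q k" if "k \<noteq> j"
      using N_dvd_mult_Q[OF \<open>k \<in> {1..a}\<close> P_dvd_m] \<open>k \<in> {1..a}\<close> ik that by blast
    have m_w: "int N dvd m * w"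
      using N_dvd_mult_Q[OF ja(1) P_dvd_Q[OF ja]] unfolding w_def m by (simp only: mult_ac)
    show ?thesis
      using that(4,5) ik Q_Q w_Q Q_w m_Q m_w unfolding u_def v_def
      by (auto simp: N_dvd_mult_diff split: if_splits)
  qed
  have "card {1..a} \<le> d"
  proof (rule zero_divisor_graph_cocktail_party[OF rep])
    show "u i \<in> pverts G \<and> v i \<in> pverts G" if i: "i \<in> {1..a}" for i
    proof -
      have "w \<in> pverts G" "int N - w \<in> pverts G"
        using \<open>w > 0\<close> \<open>w < int N\<close> pjw pjN
        by (auto intro!: zero_divisor_graph_vertexI[OF _ _ pj])
      moreover have "m \<in> pverts G"
        using \<open>m > 0\<close> \<open>m < Q 1\<close> Q_less_N[OF 1] pj_dvd_m pjN
        by (intro zero_divisor_graph_vertexI[OF _ _ pj]) auto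
      ultimately show ?thesis using Q_vertex i by (auto simp: u_def v_def)
    qed
    show "u i \<noteq> v i" if "i \<in> {1..a}" for i
    proof -
      have "w \<noteq> int N - w"
      proof
        assume "w = int N - w"
        then have "q * w = 2 * w" using Nw by simp
        then show False using \<open>odd q\<close> \<open>w > 0\<close> by simp
      qed
      moreover have "P i \<noteq> 2" if "i \<noteq> 1"
        using P_eq_2D \<open>i \<in> {1..a}\<close> that by blast
      ultimately show ?thesis
        using Q_neq[OF that] \<open>m < Q 1\<close> by (auto simp: u_def v_def)
    qed
    show "\<not> int N dvd x * y" if "i \<in> {1..a}" "x \<in> {u i, v i}" "y \<in> {u i, v i}" for i x y
      using that w_square odd_not_dvd \<open>odd m\<close> \<open>odd (Q 1)\<close> not_N_dvd_Q_square[OF that(1)]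
      unfolding u_def v_def by (auto simp: N_dvd_mult_diff split: if_splits)
    show "int N dvd x * y"
      if "i \<in> {1..a}" "k \<in> {1..a}" "i \<noteq> k" "x \<in> {u i, v i}" "y \<in> {u k, v k}" for i k x y
      using N_dvd[of i k x y] N_dvd[of k i y x] that by (cases "i < k") (auto simp: mult.commute)
  qed simp
  then show ?thesis by simp
qed

end

section \<open>Combining upper and lower bounds\<close>

theorem theorem2p6:
  fixes N a :: nat and p n :: "nat \<Rightarrow> nat"
  assumes "a \<ge> 2"
    and "\<forall>i\<in>{1..a}. prime (p i)"
    and "strict_mono_on {1..a} p"
    and "\<forall>i\<in>{1..a}. n i > 0"
    and "N = (\<Prod>i=1..a. p i ^ n i)"
  shows "boxicity (zero_divisor_graph (residue_ring (int N))) =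
    (if [N = 2] (mod 4) \<and> (\<forall>i\<in>{2..a}. n i \<le> 2) then a - 1 else a)"
proof -
  interpret factored_modulus N a p n
    by unfold_locales (use assms in auto)
  have P2: "P i \<noteq> 2" if "i \<in> {2..a}" for i
    using P_eq_2D[of i] that by auto
  show ?thesis
  proof (cases "[N = 2] (mod 4) \<and> (\<forall>i\<in>{2..a}. n i \<le> 2)")
    case True
    have "boxicity G = a - 1"
    proof (rule boxicity_eqI)
      show "\<exists>f. box_representation G (a - 1) f"
        using True by (intro box_representation_parity) (auto simp: cong_2_mod_4_iff)
      show "a - 1 \<le> d" if "box_representation G d f" for d f
        using box_representation_ge[OF that, of "{2..a}"] P2 by simp
    qed
    with True show ?thesis by simp
  next
    case False
    have "boxicity G = a"
    proof (rule boxicity_eqI[OF box_representation_all])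
      fix d f assume rep: "box_representation G d f"
      show "a \<le> d"
      \<comment> \<open>If \<open>P 1 = 2\<close>, the failing condition yields some
        \<open>j \<ge> 2\<close> with \<open>n j > 2\<close>; otherwise no prime power equals 2 and
        all \<open>a\<close> pairs are available.\<close>
      proof (cases "P 1 = 2")
        case True
        with False show ?thesis
          using box_representation_ge_cube[OF rep] by (auto simp: cong_2_mod_4_iff not_le)
      next
        case False
        then have "P i \<noteq> 2" if "i \<in> {1..a}" for i
          using P_eq_2D[OF that] by auto
        then show ?thesis
          using box_representation_ge[OF rep, of "{1..a}"] by simp
      qed
    qed
    with False show ?thesis by auto
  qed
qed

end
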